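(* Let $A$ be an invertible real $n\times n$ matrix, let $b,x_0\in\mathbb{R}^n$, and let $x_*=A^{-1}b$. Let $$S_0=\{x_*+R_A^{2i}(x_0-x_* ): i=0,1,2,\ldots\},\qquad S_1=\{x_*+R_A^{2i+1}(x_0-x_* ): i=0,1,2,\ldots\}.$$ For $j=0,1$, let $c_j$ be the center of the minimal sphere supporting $S_j$. Then $c_0+c_1=2x_*$.
   Context: Let $A_i^{T}$ denote the $i$-th row of $A$ (so $A_i$ is a column vector), let $R_i=I_n-2\frac{A_iA_i^{T}}{\|A_i\|^2}$ be the reflection generated by the $i$-th row, and let $R_A=R_n\cdots R_2R_1$. The norm $\|\cdot\|$ is the Euclidean norm. The minimal sphere supporting a set $S_j$ is the sphere of minimal dimension on which $S_j$ lies; here a sphere (of possibly lower dimension) in $\mathbb{R}^n$ is a set of the form $\{x\in V:\|x-c\|=\rho\}$ with $V$ an affine subspace of $\mathbb{R}^n$, center $c\in V$ and radius $\rho\ge 0$ (a single point is the degenerate case $\rho=0$ with $V=\{c\}$). *)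

theory Defs
  imports "HOL-Analysis.Analysis"
begin

definition reflection_matrix :: "real ^ 'n \<Rightarrow> real ^ 'n ^ 'n" where
  "reflection_matrix v = mat 1 - (2 / (norm v)\<^sup>2) *\<^sub>R (\<chi> i j. v $ i * v $ j)"

text \<open>
  Every size n at least 1 is the cardinality of a finite, linearly ordered index type.  The rows are
  numbered along that order, and the fold multiplies from the left, so that for indices
  1 < \<dots> < n the result is the product R n ** \<dots> ** R 2 ** R 1.
\<close>
definition reflection_product ::
    "real ^ ('n :: {finite, linorder}) ^ ('n :: {finite, linorder}) \<Rightarrow>
     real ^ ('n :: {finite, linorder}) ^ ('n :: {finite, linorder})" where
  "reflection_product A =
    fold (\<lambda>i M. reflection_matrix (row i A) ** M) (sorted_list_of_set UNIV) (mat 1)"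

text \<open>The class operation \<open>^\<close> on this type would be the componentwise power.\<close>
definition matrix_power :: "real ^ 'n ^ 'n \<Rightarrow> nat \<Rightarrow> real ^ 'n ^ 'n" where
  "matrix_power M k = (((**) M) ^^ k) (mat 1)"

text \<open>
  A sphere is represented by its carrier flat, centre and radius.  Radius zero is admitted only for
  the degenerate sphere carried by a single point.
\<close>
definition supporting_sphere ::
    "'a :: euclidean_space set \<Rightarrow> 'a set \<Rightarrow> 'a \<Rightarrow> real \<Rightarrow> bool" where
  "supporting_sphere S V c \<rho> \<longleftrightarrow>
    affine V \<and> c \<in> V \<and> 0 \<le> \<rho> \<and> (\<rho> = 0 \<longrightarrow> V = {c}) \<and> S \<subseteq> {x \<in> V. norm (x - c) = \<rho>}"

text \<open>
  The dimension of a sphere is measured by that of its carrier flat; this ranks a single point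
  strictly below a pair of points.
\<close>
definition minimal_supporting_sphere ::
    "'a :: euclidean_space set \<Rightarrow> 'a set \<Rightarrow> 'a \<Rightarrow> real \<Rightarrow> bool" where
  "minimal_supporting_sphere S V c \<rho> \<longleftrightarrow>
    supporting_sphere S V c \<rho> \<and>
    (\<forall>V' c' \<rho>'. supporting_sphere S V' c' \<rho>' \<longrightarrow> aff_dim V \<le> aff_dim V')"

definition minimal_sphere_center :: "'a :: euclidean_space set \<Rightarrow> 'a" where
  "minimal_sphere_center S = (THE c. \<exists>V \<rho>. minimal_supporting_sphere S V c \<rho>)"

lemma minimal_sphere_center_unique:
  fixes S :: "'a :: euclidean_space set"
  assumes "S \<noteq> {}" and sub: "S \<subseteq> sphere p r"
  shows "\<exists>!c. \<exists>V \<rho>. minimal_supporting_sphere S V c \<rho>"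
proof -
  define H where "H = affine hull S"
  have aff: "affine H" and SH: "S \<subseteq> H" and ne: "H \<noteq> {}" and cl: "closed H"
    using assms(1) hull_subset[of S affine] by (auto simp: H_def affine_closed affine_affine_hull)
  define c where "c = closest_point H p"
  have cH: "c \<in> H" using closest_point_in_set[OF cl ne] by (simp add: c_def)
  have orth: "(p - c) \<bullet> (x - c) = 0" if "x \<in> H" for x
  proof -
    have a: "(p - c) \<bullet> (y - c) \<le> 0" if "y \<in> H" for y
      using closest_point_dot[OF affine_imp_convex[OF aff] cl that, of p] by (simp add: c_def)
    have "2 *\<^sub>R c + (-1) *\<^sub>R x \<in> H"
      by (rule mem_affine[OF aff cH that]) simp
    from a[OF this] have "(p - c) \<bullet> (c - x) \<le> 0"
      by (simp add: algebra_simps scaleR_2)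
    with a[OF that] show ?thesis by (simp add: inner_diff_right)
  qed
  define \<rho> where "\<rho> = sqrt (r\<^sup>2 - (norm (p - c))\<^sup>2)"
  have nx: "norm (x - c) = \<rho>" if "x \<in> S" for x
  proof -
    have "norm (x - p) = r" using sub that by (auto simp: dist_norm norm_minus_commute)
    moreover have "(norm (x - p))\<^sup>2 = (norm (x - c))\<^sup>2 + (norm (p - c))\<^sup>2"
      using orth[of x] SH that
      by (simp add: power2_norm_eq_inner inner_diff inner_commute algebra_simps subset_iff)
    ultimately have "(norm (x - c))\<^sup>2 = r\<^sup>2 - (norm (p - c))\<^sup>2" by simp
    then show ?thesis by (metis \<rho>_def norm_ge_zero real_sqrt_unique)
  qed
  have "\<rho> \<ge> 0" using nx assms(1) by force
  moreover have "H = {c}" if "\<rho> = 0"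
  proof -
    have "S = {c}" using nx that assms(1) by auto
    then show ?thesis by (simp add: H_def)
  qed
  ultimately have sup: "supporting_sphere S H c \<rho>"
    using aff cH SH nx by (auto simp: supporting_sphere_def)
  have HV: "H \<subseteq> V" if "supporting_sphere S V c' \<rho>'" for V c' \<rho>'
    using that unfolding supporting_sphere_def H_def by (metis (lifting) hull_minimal mem_Collect_eq subset_iff)
  have mins: "minimal_supporting_sphere S H c \<rho>"
    using sup aff_dim_subset[OF HV] unfolding minimal_supporting_sphere_def by blast
  show ?thesis
  proof (rule ex1I)
    show "\<exists>V \<rho>. minimal_supporting_sphere S V c \<rho>" using mins by blast
  next
    fix c' assume "\<exists>V \<rho>. minimal_supporting_sphere S V c' \<rho>"
    then obtain V \<rho>' where m: "minimal_supporting_sphere S V c' \<rho>'" by blast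
    then have s: "supporting_sphere S V c' \<rho>'" and "aff_dim V \<le> aff_dim H"
      using sup by (auto simp: minimal_supporting_sphere_def)
    then have "V = H"
      using HV[OF s] aff ne aff_dim_subset[of H V] affine_dim_equal[of H V]
      by (auto simp: supporting_sphere_def)
    then have c'H: "c' \<in> H" and nx': "\<And>x. x \<in> S \<Longrightarrow> norm (x - c') = \<rho>'"
      using s by (auto simp: supporting_sphere_def)
    define k where "k = (\<rho>\<^sup>2 - \<rho>'\<^sup>2 - c \<bullet> c + c' \<bullet> c') / 2"
    have "S \<subseteq> {x. (c' - c) \<bullet> x = k}"
    proof
      fix x assume "x \<in> S"
      then have "(norm (x - c))\<^sup>2 = \<rho>\<^sup>2" "(norm (x - c'))\<^sup>2 = \<rho>'\<^sup>2"
        using nx nx' by simp_all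
      then show "x \<in> {x. (c' - c) \<bullet> x = k}"
        by (simp add: k_def power2_norm_eq_inner inner_diff inner_commute algebra_simps)
    qed
    then have "H \<subseteq> {x. (c' - c) \<bullet> x = k}"
      unfolding H_def by (rule hull_minimal) (rule affine_hyperplane)
    then have "(c' - c) \<bullet> c' = k" "(c' - c) \<bullet> c = k" using cH c'H by auto
    then have "(c' - c) \<bullet> (c' - c) = 0" by (simp add: inner_diff_right)
    then show "c' = c" by simp
  qed
qed

end

theory Submission
  imports Defs
begin

text \<open>
  Translate \<open>xs\<close> to the origin and write \<open>Q\<close> for the product of the reflections.  The centre \<open>c\<close>
  for the even orbit is the foot of the perpendicular from the origin to its affine hull.  This hull
  is mapped into itself by the isometry \<open>Q\<^sup>2\<close>, so \<open>Q\<^sup>2 c\<close> is another point of it of minimal norm and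
  hence equals \<open>c\<close>.  As \<open>Q\<close> is an isometry carrying the even orbit onto the odd one, the other centre
  is \<open>Q c\<close>.  So \<open>c + Q c\<close> is fixed by \<open>Q\<close>, and a product of reflections along linearly independent
  vectors only fixes the vectors orthogonal to all of them.
\<close>

text \<open>By Pythagoras the foot \<open>c\<close> of the perpendicular from \<open>p\<close> is
  equidistant from all points of \<open>S\<close>. The affine hull lies in every flat that carries a
  supporting sphere, so the sphere in it about \<open>c\<close> is minimal. Uniqueness then resolves
  the \<open>THE\<close>, and a centre can be identified by exhibiting it.\<close>

lemma minimal_sphere_center_eqI:
  fixes S :: "'a :: euclidean_space set"
  assumes "S \<noteq> {}" and sub: "S \<subseteq> sphere p r"
    and cH: "c \<in> affine hull S"
    and orth: "\<And>x. x \<in> S \<Longrightarrow> (p - c) \<bullet> (x - c) = 0"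
  shows "minimal_sphere_center S = c"
proof -
  define \<rho> where "\<rho> = sqrt (r\<^sup>2 - (norm (p - c))\<^sup>2)"
  have nx: "norm (x - c) = \<rho>" if "x \<in> S" for x
  proof -
    have "norm (x - p) = r" using sub that by (auto simp: dist_norm norm_minus_commute)
    moreover have "(norm (x - p))\<^sup>2 = (norm (x - c))\<^sup>2 + (norm (p - c))\<^sup>2"
      using orth[OF that]
      by (simp add: power2_norm_eq_inner inner_diff inner_commute algebra_simps)
    ultimately have "(norm (x - c))\<^sup>2 = r\<^sup>2 - (norm (p - c))\<^sup>2" by simp
    then show ?thesis by (metis \<rho>_def norm_ge_zero real_sqrt_unique)
  qed
  have "\<rho> \<ge> 0" using nx assms(1) by force
  moreover have "affine hull S = {c}" if "\<rho> = 0"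
  proof -
    have "S = {c}" using nx that assms(1) by auto
    then show ?thesis by simp
  qed
  ultimately have sup: "supporting_sphere S (affine hull S) c \<rho>"
    using cH nx hull_subset[of S affine]
    by (auto simp: supporting_sphere_def)
  moreover have "aff_dim (affine hull S) \<le> aff_dim V" if "supporting_sphere S V c' \<rho>'" for V c' \<rho>'
  proof (rule aff_dim_subset)
    show "affine hull S \<subseteq> V"
      using that by (intro hull_minimal) (auto simp: supporting_sphere_def)
  qed
  ultimately have "minimal_supporting_sphere S (affine hull S) c \<rho>"
    unfolding minimal_supporting_sphere_def by blast
  then show ?thesis
    unfolding minimal_sphere_center_def
    by (intro the1_equality minimal_sphere_center_unique[OF assms(1) sub]) blast
qed

lemma affine_hull_orthogonal_point:
  fixes S :: "'a :: euclidean_space set"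
  assumes "S \<noteq> {}"
  obtains c where "c \<in> affine hull S" "\<And>x. x \<in> affine hull S \<Longrightarrow> (p - c) \<bullet> (x - c) = 0"
proof -
  let ?H = "affine hull S"
  define c where "c = closest_point ?H p"
  have cl: "closed ?H" and ne: "?H \<noteq> {}" and aff: "affine ?H"
    using assms by (auto simp: affine_closed)
  have cH: "c \<in> ?H" using closest_point_in_set[OF cl ne] by (simp add: c_def)
  have le: "(p - c) \<bullet> (y - c) \<le> 0" if "y \<in> ?H" for y
    using closest_point_dot[OF affine_imp_convex[OF aff] cl that, of p] by (simp add: c_def)
  have "(p - c) \<bullet> (x - c) = 0" if "x \<in> ?H" for x
  proof -
    \<comment> \<open>Convexity alone gives only the inequality \<open>le\<close>. The mirror image
      of \<open>x\<close> in \<open>c\<close> also lies in the flat and supplies the opposite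
      inequality.\<close>
    have "2 *\<^sub>R c + (-1) *\<^sub>R x \<in> ?H"
      by (rule mem_affine[OF aff cH that]) simp
    from le[OF this] have "(p - c) \<bullet> (c - x) \<le> 0"
      by (simp add: algebra_simps scaleR_2)
    with le[OF that] show ?thesis by (simp add: inner_diff_right)
  qed
  with cH that show thesis by blast
qed

text \<open>The geometric core, free of matrices: all that matters about \<open>q\<close> is that it
  is a linear isometry whose only fixed vector is zero.\<close>

lemma minimal_sphere_centers_of_orbit:
  fixes q :: "'a :: euclidean_space \<Rightarrow> 'a" and y p :: 'a
  assumes q: "orthogonal_transformation q"
    and fix0: "\<And>v. q v = v \<Longrightarrow> v = 0"
  shows "minimal_sphere_center (range (\<lambda>i. p + (q ^^ (2 * i)) y)) +
         minimal_sphere_center (range (\<lambda>i. p + (q ^^ (2 * i + 1)) y)) = 2 *\<^sub>R p"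
proof -
  define T where "T = range (\<lambda>i. (q ^^ (2 * i)) y)"
  have lin: "linear q" by (rule orthogonal_transformation_linear[OF q])
  have norm_q: "norm (q v) = norm v" and inner_q: "q v \<bullet> q w = v \<bullet> w" for v w
    using q by (simp_all add: orthogonal_transformation_norm orthogonal_transformation_def)
  have norm_pow: "norm ((q ^^ k) y) = norm y" for k
    by (induction k) (simp_all add: norm_q)
  have norm_T: "norm t = norm y" if "t \<in> T" for t
    using that norm_pow by (auto simp: T_def)
  have ne: "T \<noteq> {}" by (simp add: T_def)
  obtain c where c: "c \<in> affine hull T" and perp: "\<And>x. x \<in> affine hull T \<Longrightarrow> c \<bullet> (x - c) = 0"
    using affine_hull_orthogonal_point[OF ne, of 0] by auto
  have hull: "affine hull (h ` T) = h ` (affine hull T)" if "linear h" for h :: "'a \<Rightarrow> 'a"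
    using that by (simp add: affine_hull_linear_image linear_conv_bounded_linear)
  have hull_shift: "affine hull ((+) p ` U) = (+) p ` (affine hull U)" for U
    by (rule affine_hull_translation)
  have "(q \<circ> q) ` T \<subseteq> T"
  proof -
    have "q (q ((q ^^ (2 * i)) y)) = (q ^^ (2 * Suc i)) y" for i by simp
    then show ?thesis unfolding T_def by (auto simp del: mult_Suc_right)
  qed
  then have "(q \<circ> q) ` (affine hull T) \<subseteq> affine hull T"
    unfolding hull[OF linear_compose[OF lin lin], symmetric] by (rule hull_mono)
  with c have "q (q c) \<in> affine hull T" by auto
  from perp[OF this] have "c \<bullet> q (q c) = c \<bullet> c" by (simp add: inner_diff_right)
  \<comment> \<open>Since \<open>q (q c)\<close> and \<open>c\<close> have equal norms, this square
    expands to twice the difference of \<open>c \<bullet> c\<close> and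
    \<open>c \<bullet> q (q c)\<close>.\<close>
  then have "(q (q c) - c) \<bullet> (q (q c) - c) = 0"
    by (simp add: inner_diff inner_q inner_commute)
  then have qqc: "q (q c) = c" by simp
  have "q (c + q c) = c + q c"
    by (simp add: linear_add[OF lin] qqc)
  then have sum0: "c + q c = 0" by (rule fix0)
  have "minimal_sphere_center ((+) p ` T) = p + c"
  proof (rule minimal_sphere_center_eqI)
    show "(+) p ` T \<subseteq> sphere p (norm y)"
      using norm_T by (auto simp: dist_norm)
    show "p + c \<in> affine hull ((+) p ` T)" using c hull_shift by auto
    show "(p - (p + c)) \<bullet> (x - (p + c)) = 0" if "x \<in> (+) p ` T" for x
      using that perp[OF hull_inc] by auto
  qed (use ne in simp)
  moreover have "minimal_sphere_center ((+) p ` q ` T) = p + q c"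
  proof (rule minimal_sphere_center_eqI)
    show "(+) p ` q ` T \<subseteq> sphere p (norm y)"
      using norm_T by (auto simp: dist_norm norm_q)
    show "p + q c \<in> affine hull ((+) p ` q ` T)" using c hull_shift hull[OF lin] by auto
    \<comment> \<open>For \<open>x = p + q t\<close> this is, up to sign,
      \<open>q c \<bullet> q (t - c)\<close>, so the isometry reduces it to
      \<open>perp\<close>.\<close>
    show "(p - (p + q c)) \<bullet> (x - (p + q c)) = 0" if "x \<in> (+) p ` q ` T" for x
      using that perp[OF hull_inc] by (auto simp: inner_q simp flip: linear_diff[OF lin])
  qed (use ne in simp)
  moreover have "range (\<lambda>i. p + (q ^^ (2 * i)) y) = (+) p ` T"
    and "range (\<lambda>i. p + (q ^^ (2 * i + 1)) y) = (+) p ` q ` T"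
    by (simp_all add: T_def image_image)
  moreover have "p + c + (p + q c) = 2 *\<^sub>R p + (c + q c)"
    by (simp add: scaleR_2)
  ultimately show ?thesis using sum0 by simp
qed

text \<open>The action of \<open>reflection_matrix\<close> on vectors. For \<open>a = 0\<close> it
  is the identity, so it is orthogonal for every \<open>a\<close> without a side condition.\<close>

definition reflect :: "'a :: real_inner \<Rightarrow> 'a \<Rightarrow> 'a" where
  "reflect a v = v - (2 * (a \<bullet> v) / (norm a)\<^sup>2) *\<^sub>R a"

lemma orthogonal_transformation_reflect: "orthogonal_transformation (reflect a)"
proof -
  have "linear (reflect a)"
    by (rule linearI)
      (simp_all add: reflect_def inner_add_right algebra_simps add_divide_distrib)
  moreover have "reflect a v \<bullet> reflect a w = v \<bullet> w" for v w
    by (cases "a = 0")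
      (simp_all add: reflect_def inner_diff inner_commute power2_norm_eq_inner field_simps)
  ultimately show ?thesis by (simp add: orthogonal_transformation_def)
qed

lemma orthogonal_transformation_fold_reflect:
  "orthogonal_transformation (fold (\<lambda>i. reflect (a i)) xs)"
  by (induction xs)
    (simp_all add: id_def orthogonal_transformation_compose[unfolded comp_def]
      orthogonal_transformation_reflect)

text \<open>Each reflection moves a vector by a multiple of its own \<open>a i\<close>, and these
  displacements add up along the list.\<close>

lemma fold_reflect_diff_in_span:
  "fold (\<lambda>i. reflect (a i)) xs v - v \<in> span (a ` set xs)"
proof (induction xs arbitrary: v)
  case Nil
  then show ?case by simp
next
  case (Cons x xs)
  let ?S = "span (a ` set (x # xs))"
  have "fold (\<lambda>i. reflect (a i)) xs (reflect (a x) v) - reflect (a x) v \<in> ?S"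
    using Cons span_mono[of "a ` set xs" "a ` set (x # xs)"] by auto
  moreover have "reflect (a x) v - v \<in> ?S"
    by (simp add: reflect_def span_base span_mul span_neg)
  ultimately have "(fold (\<lambda>i. reflect (a i)) xs (reflect (a x) v) - reflect (a x) v) +
      (reflect (a x) v - v) \<in> ?S"
    by (rule span_add)
  then show ?case by simp
qed

text \<open>The first reflection displaces \<open>v\<close> by a multiple of its own vector, and the
  remaining ones must undo this inside the span of the others. Independence makes the displacement
  vanish, so \<open>v\<close> is orthogonal to the first vector, is fixed by the rest, and the
  induction continues.\<close>

lemma fold_reflect_fixed_imp_orthogonal:
  assumes "fold (\<lambda>i. reflect (a i)) xs v = v" and "distinct xs"
    and "\<And>x. x \<in> set xs \<Longrightarrow> a x \<notin> span (a ` (set xs - {x}))"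
    and "x \<in> set xs"
  shows "a x \<bullet> v = 0"
  using assms
proof (induction xs)
  case Nil
  then show ?case by simp
next
  case (Cons z xs)
  let ?k = "2 * (a z \<bullet> v) / (norm (a z))\<^sup>2"
  have "v - reflect (a z) v \<in> span (a ` set xs)"
    using fold_reflect_diff_in_span[of a xs "reflect (a z) v"] Cons.prems(1) by simp
  then have "?k *\<^sub>R a z \<in> span (a ` set xs)" by (simp add: reflect_def)
  moreover have nz: "a z \<notin> span (a ` set xs)"
    using Cons.prems(2) Cons.prems(3)[of z] by simp
  ultimately have "?k = 0"
    using span_mul[of "?k *\<^sub>R a z" _ "inverse ?k"] by (cases "?k = 0") auto
  moreover have "a z \<noteq> 0" using nz span_zero by metis
  ultimately have z: "a z \<bullet> v = 0" by simp
  then have "reflect (a z) v = v" by (simp add: reflect_def)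
  then have "fold (\<lambda>i. reflect (a i)) xs v = v"
    using Cons.prems(1) by simp
  moreover have "a i \<notin> span (a ` (set xs - {i}))" if "i \<in> set xs" for i
    using Cons.prems(3)[of i] that span_mono[of "a ` (set xs - {i})" "a ` (set (z # xs) - {i})"]
    by auto
  ultimately show ?case
    using Cons.IH Cons.prems(2,4) z by auto
qed

lemma reflection_matrix_mult_vec: "reflection_matrix a *v v = reflect a v"
  by (simp add: vec_eq_iff reflection_matrix_def reflect_def matrix_vector_mult_diff_rdistrib
      matrix_vector_mul_lid scaleR_matrix_vector_assoc[symmetric])
    (simp add: matrix_vector_mult_def inner_vec_def sum_distrib_left sum_distrib_right
      sum_divide_distrib mult_ac)

lemma reflection_product_mult_vec:
  "reflection_product A *v v = fold (\<lambda>i. reflect (row i A)) (sorted_list_of_set UNIV) v"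
proof -
  \<comment> \<open>The initial matrix is arbitrary because \<open>fold\<close> changes its
    accumulator at each step; the product itself starts from \<open>mat 1\<close>.\<close>
  have "fold (\<lambda>i M. reflection_matrix (row i A) ** M) xs M *v v =
      fold (\<lambda>i. reflect (row i A)) xs (M *v v)" for xs M
    by (induction xs arbitrary: M)
      (simp_all add: reflection_matrix_mult_vec flip: matrix_vector_mul_assoc)
  then show ?thesis by (simp add: reflection_product_def)
qed

lemma matrix_power_mult_vec: "matrix_power M k *v v = ((*v) M ^^ k) v"
  by (induction k) (simp_all add: matrix_power_def flip: matrix_vector_mul_assoc)

text \<open>The columns of the inverse form the dual basis of the rows: column \<open>i\<close> is
  orthogonal to every row except row \<open>i\<close>, with which its inner product is 1.\<close>

lemma invertible_row_notin_span:
  fixes A :: "real ^ 'n ^ 'n"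
  assumes "invertible A"
  shows "row i A \<notin> span ((\<lambda>j. row j A) ` (UNIV - {i}))"
proof
  assume in_span: "row i A \<in> span ((\<lambda>j. row j A) ` (UNIV - {i}))"
  obtain B where "A ** B = mat 1" using assms by (auto simp: invertible_def)
  moreover have "column i B \<bullet> row j A = (A ** B) $ j $ i" for j
    by (simp add: matrix_matrix_mult_def inner_vec_def row_def column_def mult.commute)
  ultimately have dual: "column i B \<bullet> row j A = (if j = i then 1 else 0)" for j
    by (simp add: mat_def)
  have "orthogonal (column i B) (row i A)"
    by (rule orthogonal_to_span[OF in_span]) (auto simp: orthogonal_def dual split: if_splits)
  then show False using dual[of i] by (simp add: orthogonal_def)
qed

lemma reflection_product_fixed_imp_zero:
  assumes "invertible A" and "reflection_product A *v v = v"
  shows "v = 0"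
proof -
  have "row i A \<bullet> v = 0" for i
    by (rule fold_reflect_fixed_imp_orthogonal[where xs = "sorted_list_of_set UNIV"])
      (use assms invertible_row_notin_span in \<open>simp_all add: reflection_product_mult_vec\<close>)
  \<comment> \<open>The entries of \<open>A *v v\<close> are the inner products of the rows with
    \<open>v\<close>, so a fixed vector lies in the trivial kernel of \<open>A\<close>.\<close>
  then have "A *v v = 0"
    by (simp add: vec_eq_iff matrix_vector_mul_component row_def vec_nth_inverse)
  then show ?thesis
    using assms(1) by (metis invertible_def matrix_left_invertible_ker)
qed

theorem theorem7:
  fixes A :: "real ^ ('n :: {finite, linorder}) ^ ('n :: {finite, linorder})"
    and b x0 xs c0 c1 :: "real ^ ('n :: {finite, linorder})"
    and S0 S1 :: "(real ^ ('n :: {finite, linorder})) set"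
  assumes "invertible A"
    and "xs = matrix_inv A *v b"
    and "S0 = {xs + matrix_power (reflection_product A) (2 * i) *v (x0 - xs) | i :: nat. True}"
    and "S1 = {xs + matrix_power (reflection_product A) (2 * i + 1) *v (x0 - xs) | i :: nat. True}"
    and "c0 = minimal_sphere_center S0"
    and "c1 = minimal_sphere_center S1"
  shows "c0 + c1 = 2 *\<^sub>R xs"
proof -
  let ?q = "(*v) (reflection_product A)"
  have "orthogonal_transformation ?q"
    unfolding reflection_product_mult_vec by (rule orthogonal_transformation_fold_reflect)
  then show ?thesis
    \<comment> \<open>Matrix powers become iterates and the comprehensions become ranges, which are
      the two orbits with \<open>p = xs\<close> and \<open>y = x0 - xs\<close>.\<close>
    unfolding assms(3-6) matrix_power_mult_vec simp_thms full_SetCompr_eq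
    by (rule minimal_sphere_centers_of_orbit) (rule reflection_product_fixed_imp_zero[OF assms(1)])
qed

end
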